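(* Let $N\ge 2$ and let $\mathscr{T}_{LR}=\mathscr{M}_l+\mathscr{A}_l+\mathscr{M}_r+\mathscr{A}_r$ be the substructured operator of the $N$-strip domain decomposition of the Helmholtz problem in left-right numbering, with $C_r=(I-\mathscr{M}_r)^{-1}\mathscr{A}_r$ and $C_l=(I-\mathscr{M}_l)^{-1}\mathscr{A}_l$. Let $M^{-1}_{BGS}:=(I-\mathscr{M}_r-\mathscr{M}_l-\mathscr{A}_r)^{-1}$ be the Block Gauss-Seidel preconditioner for $I-\mathscr{T}_{LR}$, and let $R_{BGS}:=M_{BGS}^{-1}\bigl(M_{BGS}-(I-\mathscr{T}_{LR})\bigr)$ be its error propagation operator. Then $$R_{BGS}=(I+C_r)\,C_l,$$ and for every integer $n\ge1$, $$R_{BGS}^n=(I+C_r)\,C_l\,(C_r\,C_l)^{n-1}.$$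
   Context: Setting. A bounded domain $\Omega\subset\mathbb{R}^2$ is decomposed into $N\ge 2$ successive strips $\Omega_1,\dots,\Omega_N$ (with or without overlap). The part of $\partial\Omega_i\setminus\partial\Omega$ on the left (right) of $\Omega_i$ is the interface $\Gamma_{i,l}$ ($\Gamma_{i,r}$); $\Gamma_{1,l}=\Gamma_{N,r}=\emptyset$. Linear interface operators $\mathcal{B}_{i,l}$ ($2\le i\le N$) and $\mathcal{B}_{i,r}$ ($1\le i\le N-1$) are given, with traces taken on $\Gamma_{i,l}$ and $\Gamma_{i,r}$. For interface functions $h_l,h_r$ and a source $f$, $S_i(h_l,h_r,f)$ denotes the solution $v$ of $(-k^2-\Delta)v=f$ in $\Omega_i$, $\mathcal{B}_{i,l}(v)=h_l$ on $\Gamma_{i,l}$ (if $i\ge2$), $\mathcal{B}_{i,r}(v)=h_r$ on $\Gamma_{i,r}$ (if $i\le N-1$), with fixed linear homogeneous boundary conditions on $\partial\Omega\cap\partial\Omega_i$; these local problems are assumed well posed, so that $S_i$ is linear (for $i=1$ the argument $h_l$ is ignored, for $i=N$ the argument $h_r$ is ignored). Substructured operator. The unknowns are interface functions ordered in the left-right (LR) numbering $(h_{2,l},h_{3,l},\dots,h_{N,l},h_{N-1,r},h_{N-2,r},\dots,h_{1,r})$, i.e. $2N-2$ components. $\mathscr{T}_{LR}$ is the $(2N-2)\times(2N-2)$ matrix of linear operators whose only possibly nonzero entries (row index first, column index second) are $\mathscr{T}_{(i+1,l)(i,l)}=\mathcal{B}_{i+1,l}(S_i(\cdot,0,0))$ for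 $2\le i\le N-1$; $\mathscr{T}_{(i+1,l)(i,r)}=\mathcal{B}_{i+1,l}(S_i(0,\cdot,0))$ for $1\le i\le N-1$; $\mathscr{T}_{(i-1,r)(i,r)}=\mathcal{B}_{i-1,r}(S_i(0,\cdot,0))$ for $2\le i\le N-1$; $\mathscr{T}_{(i-1,r)(i,l)}=\mathcal{B}_{i-1,r}(S_i(\cdot,0,0))$ for $2\le i\le N$. Submatrices. $I$ is the identity. Let $I_l$ (resp. $I_r$) be the diagonal $(2N-2)\times(2N-2)$ matrix with diagonal entries $1$ in positions $1,\dots,N-1$ (resp. $N,\dots,2N-2$) and $0$ elsewhere. Set $\mathscr{M}_l:=I_l^T\mathscr{T}_{LR}I_l$, $\mathscr{A}_l:=I_l^T\mathscr{T}_{LR}I_r$, $\mathscr{A}_r:=I_r^T\mathscr{T}_{LR}I_l$, $\mathscr{M}_r:=I_r^T\mathscr{T}_{LR}I_r$. The matrices $\mathscr{M}_l,\mathscr{M}_r$ are strictly lower triangular with $\mathscr{M}_l^{N-1}=\mathscr{M}_r^{N-1}=0$. Define $C_r:=(I-\mathscr{M}_r)^{-1}\mathscr{A}_r=\bigl(\sum_{i=0}^{N-2}\mathscr{M}_r^i\bigr)\mathscr{A}_r$ and $C_l:=(I-\mathscr{M}_l)^{-1}\mathscr{A}_l=\bigl(\sum_{i=0}^{N-2}\mathscr{M}_l^i\bigr)\mathscr{A}_l$. Error propagation operator. For a preconditioner $M^{-1}$ (with inverse $M$) of a linear operator $B$, the error propagation operator is $R:=M^{-1}(M-B)$; here $B=I-\mathscr{T}_{LR}$.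 *)

theory Defs
  imports
    "HOL-Analysis.Analysis"
    "HOL-Algebra.Ring"
    "HOL-Library.Function_Algebras"
begin

section \<open>Distributions on planar open sets\<close>

text \<open>
  No function space is prescribed for the local solutions or for the interface data (classical,
  Sobolev, broken or negative-order spaces are all used in practice). Both are therefore modelled as
  distributions, and the actual spaces are parameters, see the record below. Interface data are the
  distributions that only depend on the values of the test function on the interface, such as
  the functional sending \<phi> to the integral of h * \<phi> over \<Gamma>.
\<close>

type_synonym plane = "real^2"
type_synonym dist = "(plane \<Rightarrow> complex) \<Rightarrow> complex"

definition partial_deriv :: "2 \<Rightarrow> (plane \<Rightarrow> complex) \<Rightarrow> plane \<Rightarrow> complex" where
  "partial_deriv j \<phi> = (\<lambda>x. frechet_derivative \<phi> (at x) (axis j 1))"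

definition iterated_partial :: "2 list \<Rightarrow> (plane \<Rightarrow> complex) \<Rightarrow> plane \<Rightarrow> complex" where
  "iterated_partial \<alpha> \<phi> = foldr partial_deriv \<alpha> \<phi>"

definition laplacian :: "(plane \<Rightarrow> complex) \<Rightarrow> plane \<Rightarrow> complex" where
  "laplacian \<phi> = (\<lambda>x. \<Sum>j\<in>UNIV. partial_deriv j (partial_deriv j \<phi>) x)"

definition test_functions :: "plane set \<Rightarrow> (plane \<Rightarrow> complex) set" where
  "test_functions U = {\<phi>. (\<forall>\<alpha> x. iterated_partial \<alpha> \<phi> differentiable (at x)) \<and>
     compact (closure {x. \<phi> x \<noteq> 0}) \<and> closure {x. \<phi> x \<noteq> 0} \<subseteq> U}"

text \<open>
  A distribution on \<open>U\<close> is extended by \<open>0\<close> to arguments that are not test functions on \<open>U\<close>, so that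
  equality of distributions is equality of HOL functions. The last clause is the usual seminorm
  form of continuity; \<open>b\<close> bounds all partial derivatives of order at most \<open>m\<close>.
\<close>

definition distributions :: "plane set \<Rightarrow> dist set" where
  "distributions U = {u.
     (\<forall>\<phi>. \<phi> \<notin> test_functions U \<longrightarrow> u \<phi> = 0) \<and>
     (\<forall>\<phi>\<in>test_functions U. \<forall>\<psi>\<in>test_functions U. \<forall>a b.
        u (\<lambda>x. a * \<phi> x + b * \<psi> x) = a * u \<phi> + b * u \<psi>) \<and>
     (\<forall>K. compact K \<and> K \<subseteq> U \<longrightarrow>
        (\<exists>C m. \<forall>\<phi>\<in>test_functions U. \<forall>b.
           {x. \<phi> x \<noteq> 0} \<subseteq> K \<and>
           (\<forall>\<alpha> x. length \<alpha> \<le> m \<longrightarrow> norm (iterated_partial \<alpha> \<phi> x) \<le> b) \<longrightarrow>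
           norm (u \<phi>) \<le> C * b))}"

definition interface_distributions :: "plane set \<Rightarrow> plane set \<Rightarrow> dist set" where
  "interface_distributions U \<Gamma> = {h \<in> distributions U.
     \<forall>\<phi>\<in>test_functions U. \<forall>\<psi>\<in>test_functions U. (\<forall>x\<in>\<Gamma>. \<phi> x = \<psi> x) \<longrightarrow> h \<phi> = h \<psi>}"

definition helmholtz :: "complex \<Rightarrow> plane set \<Rightarrow> dist \<Rightarrow> dist" where
  "helmholtz k U u = (\<lambda>\<phi>. if \<phi> \<in> test_functions U
     then u (\<lambda>x. - k\<^sup>2 * \<phi> x - laplacian \<phi> x) else 0)"

definition dist_scale :: "complex \<Rightarrow> dist \<Rightarrow> dist" where
  "dist_scale c u = (\<lambda>\<phi>. c * u \<phi>)"

definition dist_subspace :: "dist set \<Rightarrow> bool" where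
  "dist_subspace X \<longleftrightarrow> 0 \<in> X \<and> (\<forall>u\<in>X. \<forall>v\<in>X. u + v \<in> X) \<and> (\<forall>c. \<forall>u\<in>X. dist_scale c u \<in> X)"

definition linear_on_space :: "dist set \<Rightarrow> (dist \<Rightarrow> dist) \<Rightarrow> bool" where
  "linear_on_space X T \<longleftrightarrow> (\<forall>u\<in>X. \<forall>v\<in>X. T (u + v) = T u + T v) \<and>
     (\<forall>c. \<forall>u\<in>X. T (dist_scale c u) = dist_scale c (T u))"

section \<open>Strip decompositions\<close>

datatype side = Lft | Rgt

text \<open>
  Subdomains are numbered from 1 to \<open>N\<close>, and \<open>(i, s)\<close> is side \<open>s\<close> of subdomain \<open>i\<close>.
  \<open>interface_op D (i, s) j\<close> is the operator \<open>B\<close> of the interface \<open>(i, s)\<close> applied to fields living on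
  subdomain \<open>j\<close>: it is needed for \<open>j = i\<close> and for the neighbour of \<open>i\<close> across that interface, and for a
  decomposition without overlap the two traces are taken from opposite sides of the interface.
  \<open>physical_bc D i v = 0\<close> expresses the homogeneous boundary conditions on the part
  of the boundary of \<open>\<Omega>\<close> that belongs to the boundary of subdomain \<open>i\<close>.
\<close>

record strip_ddm =
  num_strips :: nat
  wavenumber :: complex
  domain :: "plane set"
  subdomain :: "nat \<Rightarrow> plane set"
  interface :: "nat \<times> side \<Rightarrow> plane set"
  field_space :: "nat \<Rightarrow> dist set"
  source_space :: "nat \<Rightarrow> dist set"
  interface_space :: "nat \<times> side \<Rightarrow> dist set"
  interface_op :: "nat \<times> side \<Rightarrow> nat \<Rightarrow> dist \<Rightarrow> dist"
  physical_bc :: "nat \<Rightarrow> dist \<Rightarrow> dist"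

fun neighbour :: "nat \<times> side \<Rightarrow> nat" where
  "neighbour (i, Lft) = i - 1"
| "neighbour (i, Rgt) = i + 1"

definition interface_indices :: "nat \<Rightarrow> (nat \<times> side) set" where
  "interface_indices N = {2..N} \<times> {Lft} \<union> {1..N - 1} \<times> {Rgt}"

definition is_local_solution ::
    "strip_ddm \<Rightarrow> nat \<Rightarrow> dist \<Rightarrow> dist \<Rightarrow> dist \<Rightarrow> dist \<Rightarrow> bool" where
  "is_local_solution D i hl hr f v \<longleftrightarrow>
     v \<in> field_space D i \<and>
     helmholtz (wavenumber D) (subdomain D i) v = f \<and>
     (2 \<le> i \<longrightarrow> interface_op D (i, Lft) i v = hl) \<and>
     (i \<le> num_strips D - 1 \<longrightarrow> interface_op D (i, Rgt) i v = hr) \<and>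
     physical_bc D i v = 0"

definition local_solve :: "strip_ddm \<Rightarrow> nat \<Rightarrow> dist \<Rightarrow> dist \<Rightarrow> dist \<Rightarrow> dist" where
  "local_solve D i hl hr f = (THE v. is_local_solution D i hl hr f v)"

text \<open>
  The left (right) part of the boundary of a strip is the one facing the previous (next) strip.
  The inclusion in the closure of the neighbour says that the neighbouring field has a trace on it,
  with or without overlap.
\<close>

definition strip_geometry :: "strip_ddm \<Rightarrow> bool" where
  "strip_geometry D \<longleftrightarrow>
     (let N = num_strips D; \<Omega> = domain D; \<Omega>s = subdomain D; \<Gamma> = interface D in
       2 \<le> N \<and>
       open \<Omega> \<and> connected \<Omega> \<and> bounded \<Omega> \<and> \<Omega> \<noteq> {} \<and>
       (\<forall>i\<in>{1..N}. open (\<Omega>s i) \<and> \<Omega>s i \<noteq> {} \<and> \<Omega>s i \<subseteq> \<Omega>) \<and>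
       \<Omega> \<subseteq> (\<Union>i\<in>{1..N}. closure (\<Omega>s i)) \<and>
       (\<forall>i\<in>{1..N}. \<Gamma> (i, Lft) \<union> \<Gamma> (i, Rgt) = frontier (\<Omega>s i) - frontier \<Omega> \<and>
                   \<Gamma> (i, Lft) \<inter> \<Gamma> (i, Rgt) = {}) \<and>
       \<Gamma> (1, Lft) = {} \<and> \<Gamma> (N, Rgt) = {} \<and>
       (\<forall>p\<in>interface_indices N. \<Gamma> p \<subseteq> closure (\<Omega>s (neighbour p))))"

definition strip_operators :: "strip_ddm \<Rightarrow> bool" where
  "strip_operators D \<longleftrightarrow>
     (\<forall>i\<in>{1..num_strips D}.
        dist_subspace (field_space D i) \<and> field_space D i \<subseteq> distributions (subdomain D i) \<and>
        dist_subspace (source_space D i) \<and> source_space D i \<subseteq> distributions (subdomain D i) \<and>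
        linear_on_space (field_space D i) (physical_bc D i)) \<and>
     (\<forall>p\<in>interface_indices (num_strips D).
        dist_subspace (interface_space D p) \<and>
        interface_space D p \<subseteq> interface_distributions (domain D) (interface D p) \<and>
        (\<forall>j\<in>{fst p, neighbour p}.
           linear_on_space (field_space D j) (interface_op D p j) \<and>
           interface_op D p j ` field_space D j \<subseteq> interface_space D p))"

definition locally_well_posed :: "strip_ddm \<Rightarrow> bool" where
  "locally_well_posed D \<longleftrightarrow>
     (\<forall>i\<in>{1..num_strips D}. \<forall>hl hr. \<forall>f\<in>source_space D i.
        (2 \<le> i \<longrightarrow> hl \<in> interface_space D (i, Lft)) \<and>
        (i \<le> num_strips D - 1 \<longrightarrow> hr \<in> interface_space D (i, Rgt)) \<longrightarrow>
        (\<exists>!v. is_local_solution D i hl hr f v))"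

definition strip_decomposition :: "strip_ddm \<Rightarrow> bool" where
  "strip_decomposition D \<longleftrightarrow> strip_geometry D \<and> strip_operators D \<and> locally_well_posed D"

section \<open>Matrices of linear operators\<close>

text \<open>
  Positions run from 1 to \<open>m\<close>, and \<open>X p\<close> is the space of the component in position \<open>p\<close>. An operator
  from \<open>X q\<close> to \<open>X p\<close> is extended by \<open>0\<close> off \<open>X q\<close>, and a matrix by \<open>0\<close> off its index range, so that
  equality of matrices is equality of HOL functions.
\<close>

type_synonym opmat = "nat \<Rightarrow> nat \<Rightarrow> dist \<Rightarrow> dist"

definition linear_operators :: "dist set \<Rightarrow> dist set \<Rightarrow> (dist \<Rightarrow> dist) set" where
  "linear_operators X Y =
     {T. linear_on_space X T \<and> T ` X \<subseteq> Y \<and> (\<forall>h. h \<notin> X \<longrightarrow> T h = 0)}"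

definition diag_opmat :: "(nat \<Rightarrow> dist set) \<Rightarrow> nat set \<Rightarrow> opmat" where
  "diag_opmat X P = (\<lambda>p q h. if p = q \<and> p \<in> P \<and> h \<in> X q then h else 0)"

definition opmat_ring :: "nat \<Rightarrow> (nat \<Rightarrow> dist set) \<Rightarrow> opmat ring" where
  "opmat_ring m X = \<lparr>
     carrier = {A. \<forall>p q. if p \<in> {1..m} \<and> q \<in> {1..m}
                         then A p q \<in> linear_operators (X q) (X p) else A p q = 0},
     mult = (\<lambda>A B p q h. \<Sum>s\<in>{1..m}. A p s (B s q h)),
     one = diag_opmat X {1..m},
     zero = 0,
     add = (\<lambda>A B. A + B)\<rparr>"

definition opmat_transpose :: "opmat \<Rightarrow> opmat" where
  "opmat_transpose A = (\<lambda>p q. A q p)"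

section \<open>The substructured operator in left-right numbering\<close>

definition LR_index :: "nat \<Rightarrow> nat \<Rightarrow> nat \<times> side" where
  "LR_index N p = (if p \<le> N - 1 then (p + 1, Lft) else (2 * N - 1 - p, Rgt))"

text \<open>Entry in row \<open>r\<close> and column \<open>c\<close>, applied to \<open>h\<close>.\<close>

definition transmission :: "strip_ddm \<Rightarrow> nat \<times> side \<Rightarrow> nat \<times> side \<Rightarrow> dist \<Rightarrow> dist" where
  "transmission D r c h =
     (let N = num_strips D; i = fst c in
      if snd c = Lft \<and> r = (i + 1, Lft) \<and> 2 \<le> i \<and> i \<le> N - 1
        then interface_op D (i + 1, Lft) i (local_solve D i h 0 0)
      else if snd c = Rgt \<and> r = (i + 1, Lft) \<and> 1 \<le> i \<and> i \<le> N - 1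
        then interface_op D (i + 1, Lft) i (local_solve D i 0 h 0)
      else if snd c = Rgt \<and> r = (i - 1, Rgt) \<and> 2 \<le> i \<and> i \<le> N - 1
        then interface_op D (i - 1, Rgt) i (local_solve D i 0 h 0)
      else if snd c = Lft \<and> r = (i - 1, Rgt) \<and> 2 \<le> i \<and> i \<le> N
        then interface_op D (i - 1, Rgt) i (local_solve D i h 0 0)
      else 0)"

definition LR_space :: "strip_ddm \<Rightarrow> nat \<Rightarrow> dist set" where
  "LR_space D p = interface_space D (LR_index (num_strips D) p)"

definition LR_ring :: "strip_ddm \<Rightarrow> opmat ring" where
  "LR_ring D = opmat_ring (2 * num_strips D - 2) (LR_space D)"

definition T_LR :: "strip_ddm \<Rightarrow> opmat" where
  "T_LR D = (\<lambda>p q h.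
     let N = num_strips D in
     if p \<in> {1..2 * N - 2} \<and> q \<in> {1..2 * N - 2} \<and> h \<in> LR_space D q
     then transmission D (LR_index N p) (LR_index N q) h else 0)"

definition I_l :: "strip_ddm \<Rightarrow> opmat" where
  "I_l D = diag_opmat (LR_space D) {1..num_strips D - 1}"

definition I_r :: "strip_ddm \<Rightarrow> opmat" where
  "I_r D = diag_opmat (LR_space D) {num_strips D..2 * num_strips D - 2}"

definition M_l :: "strip_ddm \<Rightarrow> opmat" where
  "M_l D = opmat_transpose (I_l D) \<otimes>\<^bsub>LR_ring D\<^esub> T_LR D \<otimes>\<^bsub>LR_ring D\<^esub> I_l D"

definition A_l :: "strip_ddm \<Rightarrow> opmat" where
  "A_l D = opmat_transpose (I_l D) \<otimes>\<^bsub>LR_ring D\<^esub> T_LR D \<otimes>\<^bsub>LR_ring D\<^esub> I_r D"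

definition A_r :: "strip_ddm \<Rightarrow> opmat" where
  "A_r D = opmat_transpose (I_r D) \<otimes>\<^bsub>LR_ring D\<^esub> T_LR D \<otimes>\<^bsub>LR_ring D\<^esub> I_l D"

definition M_r :: "strip_ddm \<Rightarrow> opmat" where
  "M_r D = opmat_transpose (I_r D) \<otimes>\<^bsub>LR_ring D\<^esub> T_LR D \<otimes>\<^bsub>LR_ring D\<^esub> I_r D"

definition C_l :: "strip_ddm \<Rightarrow> opmat" where
  "C_l D = inv\<^bsub>LR_ring D\<^esub> (\<one>\<^bsub>LR_ring D\<^esub> \<ominus>\<^bsub>LR_ring D\<^esub> M_l D) \<otimes>\<^bsub>LR_ring D\<^esub> A_l D"

definition C_r :: "strip_ddm \<Rightarrow> opmat" where
  "C_r D = inv\<^bsub>LR_ring D\<^esub> (\<one>\<^bsub>LR_ring D\<^esub> \<ominus>\<^bsub>LR_ring D\<^esub> M_r D) \<otimes>\<^bsub>LR_ring D\<^esub> A_r D"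

text \<open>\<open>M\<close> is the inverse of the preconditioner, i.e. the matrix that is to be inverted.\<close>

definition error_propagation :: "('a, 'b) ring_scheme \<Rightarrow> 'a \<Rightarrow> 'a \<Rightarrow> 'a" where
  "error_propagation R M B = inv\<^bsub>R\<^esub> M \<otimes>\<^bsub>R\<^esub> (M \<ominus>\<^bsub>R\<^esub> B)"

definition M_BGS :: "strip_ddm \<Rightarrow> opmat" where
  "M_BGS D = \<one>\<^bsub>LR_ring D\<^esub> \<ominus>\<^bsub>LR_ring D\<^esub> M_r D \<ominus>\<^bsub>LR_ring D\<^esub> M_l D \<ominus>\<^bsub>LR_ring D\<^esub> A_r D"

definition R_BGS :: "strip_ddm \<Rightarrow> opmat" where
  "R_BGS D = error_propagation (LR_ring D) (M_BGS D) (\<one>\<^bsub>LR_ring D\<^esub> \<ominus>\<^bsub>LR_ring D\<^esub> T_LR D)"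

end

theory Submission
  imports Defs
begin

text \<open>
  Once the matrices of operators are known to form a ring, the statement is algebra in that ring.
  The projections \<open>I_l\<close> and \<open>I_r\<close> are orthogonal idempotents with sum \<open>1\<close>, so a product of
  two of the blocks \<open>M_l\<close>, \<open>A_l\<close>, \<open>A_r\<close>, \<open>M_r\<close> vanishes whenever the column side of the first differs
  from the row side of the second. This gives the factorization
  \<open>1 - M_r - M_l - A_r = (1 - M_l) (1 - M_r) (1 - C_r)\<close>. The three factors are
  invertible: the first two because \<open>M_l\<close> and \<open>M_r\<close> are nilpotent, the last one because
  \<open>C_r C_r = 0\<close>, with inverse \<open>1 + C_r\<close>. The residual matrix \<open>M - (1 - T)\<close> is \<open>A_l\<close>, hence
  \<open>R = (1 + C_r) (1 - M_r)\<inverse> (1 - M_l)\<inverse> A_l = (1 + C_r) (1 - M_r)\<inverse> C_l\<close>, and \<open>M_r C_l = 0\<close> removes the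
  remaining inverse. The powers follow from \<open>C_l (1 + C_r) C_l = C_l C_r C_l\<close>, which is \<open>C_l C_l = 0\<close>.
  This part of the argument is \<open>ring.block_gauss_seidel\<close>.

  What analysis there is serves to show that \<open>T_LR\<close> really is an element of the ring
  (\<open>T_LR_closed\<close>): by uniqueness in the local problems the solution operators are linear.
  The nilpotency comes from the numbering: \<open>M_l\<close> only transmits from one left interface to the
  next strip's, \<open>M_r\<close> only from one right interface to the previous strip's, and in left-right
  numbering both go from a position to the following one.
\<close>

section \<open>Block Gauss-Seidel in a ring\<close>

text \<open>Telescoping of the geometric series \<open>1 + a + \<dots>\<close>, whose remainder is the vanishing power.\<close>

lemma (in ring) one_minus_nilpotent_unit:
  assumes a: "a \<in> carrier R" and nil: "a [^] (k::nat) = \<zero>"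
  shows "\<one> \<ominus> a \<in> Units R"
proof -
  have "\<exists>b\<in>carrier R. (\<one> \<ominus> a) \<otimes> b = \<one> \<ominus> a [^] n \<and> b \<otimes> (\<one> \<ominus> a) = \<one> \<ominus> a [^] n" for n :: nat
  proof (induction n)
    case 0
    show ?case
      using a by (intro bexI[of _ \<zero>]) (simp_all add: r_neg minus_eq)
  next
    case (Suc n)
    then obtain b where b: "b \<in> carrier R" "(\<one> \<ominus> a) \<otimes> b = \<one> \<ominus> a [^] n"
      "b \<otimes> (\<one> \<ominus> a) = \<one> \<ominus> a [^] n" by blast
    have p: "a [^] n \<in> carrier R" using a by simp
    have "(\<one> \<ominus> a) \<otimes> (b \<oplus> a [^] n) = (\<one> \<ominus> a) \<otimes> b \<oplus> (a [^] n \<ominus> a \<otimes> a [^] n)"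
      using a b(1) p by algebra
    also have "\<dots> = \<one> \<ominus> a \<otimes> a [^] n"
      unfolding b(2) using a p by algebra
    also have "a \<otimes> a [^] n = a [^] Suc n"
      using nat_pow_Suc2[OF a] by simp
    finally have 1: "(\<one> \<ominus> a) \<otimes> (b \<oplus> a [^] n) = \<one> \<ominus> a [^] Suc n" .
    have "(b \<oplus> a [^] n) \<otimes> (\<one> \<ominus> a) = b \<otimes> (\<one> \<ominus> a) \<oplus> (a [^] n \<ominus> a [^] n \<otimes> a)"
      using a b(1) p by (simp add: ring_simprules)
    also have "\<dots> = \<one> \<ominus> a [^] n \<otimes> a"
      unfolding b(3) using a p by algebra
    finally have "(b \<oplus> a [^] n) \<otimes> (\<one> \<ominus> a) = \<one> \<ominus> a [^] Suc n" by simp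
    with 1 b(1) p show ?case by (intro bexI[of _ "b \<oplus> a [^] n"]) auto
  qed
  from this[of k] obtain b where "b \<in> carrier R"
    "(\<one> \<ominus> a) \<otimes> b = \<one>" "b \<otimes> (\<one> \<ominus> a) = \<one>"
    unfolding nil by (auto simp: minus_eq)
  then show ?thesis using a unfolding Units_def by auto
qed

text \<open>
  Through this equation \<open>C_r\<close> and \<open>C_l\<close> inherit the row structure of the blocks they are built from:
  an element that annihilates \<open>a\<close> and \<open>m\<close> from the left annihilates \<open>(1 - m)\<inverse> a\<close> as well.
\<close>

lemma (in ring) inv_one_minus_fixed_point:
  assumes "m \<in> carrier R" "a \<in> carrier R" "\<one> \<ominus> m \<in> Units R"
  shows "inv (\<one> \<ominus> m) \<otimes> a = a \<oplus> m \<otimes> (inv (\<one> \<ominus> m) \<otimes> a)"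
proof -
  define c where "c = inv (\<one> \<ominus> m) \<otimes> a"
  have c: "c \<in> carrier R" unfolding c_def using assms by simp
  have "(\<one> \<ominus> m) \<otimes> c = a"
    unfolding c_def using assms by (simp flip: m_assoc)
  moreover have "c = (\<one> \<ominus> m) \<otimes> c \<oplus> m \<otimes> c"
    using assms c by algebra
  ultimately show ?thesis by (simp add: c_def)
qed

lemma (in ring) annihilates_inv_one_minus:
  assumes "x \<in> carrier R" "m \<in> carrier R" "a \<in> carrier R" "\<one> \<ominus> m \<in> Units R"
    and "x \<otimes> a = \<zero>" "x \<otimes> m = \<zero>"
  shows "x \<otimes> (inv (\<one> \<ominus> m) \<otimes> a) = \<zero>"
proof -
  define c where "c = inv (\<one> \<ominus> m) \<otimes> a"
  have c: "c \<in> carrier R" unfolding c_def using assms by simp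
  have "x \<otimes> c = x \<otimes> (a \<oplus> m \<otimes> c)"
    unfolding c_def using inv_one_minus_fixed_point[OF assms(2-4)] by simp
  also have "\<dots> = x \<otimes> a \<oplus> (x \<otimes> m) \<otimes> c" using assms(1-3) c by algebra
  finally show ?thesis using assms c by (simp add: c_def)
qed

lemma (in monoid) inv_mult_units:
  assumes "x \<in> Units G" "y \<in> Units G"
  shows "inv (x \<otimes> y) = inv y \<otimes> inv x"
proof (rule inv_unique'[symmetric])
  have *: "x \<in> carrier G" "y \<in> carrier G" using assms by auto
  show "x \<otimes> y \<in> carrier G" "inv y \<otimes> inv x \<in> carrier G" using assms * by auto
  have "(x \<otimes> y) \<otimes> (inv y \<otimes> inv x) = x \<otimes> (y \<otimes> inv y) \<otimes> inv x"
    using assms * by (simp add: m_assoc del: Units_r_inv)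
  then show "(x \<otimes> y) \<otimes> (inv y \<otimes> inv x) = \<one>" using assms * by simp
  have "(inv y \<otimes> inv x) \<otimes> (x \<otimes> y) = inv y \<otimes> (inv x \<otimes> x) \<otimes> y"
    using assms * by (simp add: m_assoc del: Units_l_inv)
  then show "(inv y \<otimes> inv x) \<otimes> (x \<otimes> y) = \<one>" using assms * by simp
qed

text \<open>
  The algebraic core. The vanishing products say that the four matrices are the
  blocks of a two by two matrix, without any reference to the projections that cut them out.
\<close>

lemma (in ring) block_gauss_seidel:
  assumes car: "ml \<in> carrier R" "al \<in> carrier R" "ar \<in> carrier R" "mr \<in> carrier R"
    and units: "\<one> \<ominus> ml \<in> Units R" "\<one> \<ominus> mr \<in> Units R"
    and prods: "ml \<otimes> mr = \<zero>" "ml \<otimes> ar = \<zero>" "al \<otimes> ml = \<zero>" "al \<otimes> al = \<zero>"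
      "mr \<otimes> ml = \<zero>" "mr \<otimes> al = \<zero>" "ar \<otimes> mr = \<zero>" "ar \<otimes> ar = \<zero>"
  defines "cl \<equiv> inv (\<one> \<ominus> ml) \<otimes> al" and "cr \<equiv> inv (\<one> \<ominus> mr) \<otimes> ar"
    and "r \<equiv> error_propagation R (\<one> \<ominus> mr \<ominus> ml \<ominus> ar) (\<one> \<ominus> (ml \<oplus> al \<oplus> ar \<oplus> mr))"
  shows "r = (\<one> \<oplus> cr) \<otimes> cl"
    and "n \<ge> 1 \<Longrightarrow> r [^] (n::nat) = (\<one> \<oplus> cr) \<otimes> cl \<otimes> (cr \<otimes> cl) [^] (n - 1)"
proof -
  define il ir where "il = inv (\<one> \<ominus> ml)" and "ir = inv (\<one> \<ominus> mr)"
  have i: "il \<in> carrier R" "ir \<in> carrier R"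
    using units by (simp_all add: il_def ir_def)
  have c: "cl \<in> carrier R" "cr \<in> carrier R"
    using i car by (simp_all add: cl_def cr_def il_def ir_def)
  have cl_cl: "cl \<otimes> cl = \<zero>"
  proof -
    have "al \<otimes> cl = \<zero>"
      unfolding cl_def using car units prods by (intro annihilates_inv_one_minus) auto
    then show ?thesis
      using i car c by (subst (1) cl_def) (simp add: m_assoc flip: il_def)
  qed
  have cr_cr: "cr \<otimes> cr = \<zero>"
  proof -
    have "ar \<otimes> cr = \<zero>"
      unfolding cr_def using car units prods by (intro annihilates_inv_one_minus) auto
    then show ?thesis
      using i car c by (subst (1) cr_def) (simp add: m_assoc flip: ir_def)
  qed
  have mr_cl: "mr \<otimes> cl = \<zero>"
    unfolding cl_def using car units prods by (intro annihilates_inv_one_minus) auto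
  have ir_cl: "ir \<otimes> cl = cl"
  proof -
    have "(\<one> \<ominus> mr) \<otimes> cl = cl \<ominus> mr \<otimes> cl" using car c by algebra
    then have "(\<one> \<ominus> mr) \<otimes> cl = cl" using c mr_cl by (simp add: minus_eq)
    then have "ir \<otimes> cl = ir \<otimes> ((\<one> \<ominus> mr) \<otimes> cl)" by simp
    also have "\<dots> = cl"
      unfolding ir_def using car units c by (simp flip: m_assoc)
    finally show ?thesis .
  qed
  have cr_unit: "\<one> \<ominus> cr \<in> Units R" and cr_inv: "inv (\<one> \<ominus> cr) = \<one> \<oplus> cr"
  proof -
    have cancel: "x \<oplus> (y \<oplus> (\<ominus> x \<oplus> z)) = y \<oplus> z"
      if "x \<in> carrier R" "y \<in> carrier R" "z \<in> carrier R" for x y z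
      using that by (simp add: a_lcomm[of y] r_neg2)
    have "(\<one> \<ominus> cr) \<otimes> (\<one> \<oplus> cr) = \<one> \<ominus> cr \<otimes> cr"
      and "(\<one> \<oplus> cr) \<otimes> (\<one> \<ominus> cr) = \<one> \<ominus> cr \<otimes> cr"
      using c by (simp_all add: ring_simprules cancel)
    then have *: "(\<one> \<ominus> cr) \<otimes> (\<one> \<oplus> cr) = \<one>" "(\<one> \<oplus> cr) \<otimes> (\<one> \<ominus> cr) = \<one>"
      by (simp_all add: cr_cr minus_eq)
    show "\<one> \<ominus> cr \<in> Units R" using * c unfolding Units_def by auto
    show "inv (\<one> \<ominus> cr) = \<one> \<oplus> cr"
      using inv_unique'[OF _ _ *] c by simp
  qed
  have "(\<one> \<ominus> mr) \<otimes> cr = ar"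
    unfolding cr_def using car units by (simp flip: m_assoc)
  then have low: "(\<one> \<ominus> mr) \<otimes> (\<one> \<ominus> cr) = \<one> \<ominus> mr \<ominus> ar"
  proof -
    have "(\<one> \<ominus> mr) \<otimes> (\<one> \<ominus> cr) = (\<one> \<ominus> mr) \<ominus> (\<one> \<ominus> mr) \<otimes> cr" using car c by (simp add: ring_simprules)
    with \<open>(\<one> \<ominus> mr) \<otimes> cr = ar\<close> show ?thesis by simp
  qed
  \<comment> \<open>The factor \<open>1 - M_l\<close> has to stand on the left: \<open>M_l\<close> annihilates \<open>M_r\<close> and \<open>A_r\<close> from that
    side, whereas \<open>A_r M_l\<close> is not zero in general.\<close>
  have factor: "\<one> \<ominus> mr \<ominus> ml \<ominus> ar = (\<one> \<ominus> ml) \<otimes> ((\<one> \<ominus> mr) \<otimes> (\<one> \<ominus> cr))"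
  proof -
    have "(\<one> \<ominus> ml) \<otimes> (\<one> \<ominus> mr \<ominus> ar) = \<one> \<ominus> mr \<ominus> ml \<ominus> ar \<oplus> ml \<otimes> mr \<oplus> ml \<otimes> ar"
      using car by (simp add: ring_simprules)
    then show ?thesis using car by (simp add: low prods)
  qed
  have inv_factor: "inv (\<one> \<ominus> mr \<ominus> ml \<ominus> ar) = (\<one> \<oplus> cr) \<otimes> ir \<otimes> il"
    unfolding factor using units cr_unit
    by (simp add: inv_mult_units cr_inv m_assoc il_def ir_def)
  have diff: "(\<one> \<ominus> mr \<ominus> ml \<ominus> ar) \<ominus> (\<one> \<ominus> (ml \<oplus> al \<oplus> ar \<oplus> mr)) = al"
    using car by algebra
  show r: "r = (\<one> \<oplus> cr) \<otimes> cl"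
  proof -
    have "r = (\<one> \<oplus> cr) \<otimes> ir \<otimes> il \<otimes> al"
      unfolding r_def error_propagation_def diff inv_factor ..
    also have "\<dots> = (\<one> \<oplus> cr) \<otimes> (ir \<otimes> cl)"
      using i car c by (simp add: m_assoc cl_def flip: il_def)
    finally show ?thesis by (simp add: ir_cl)
  qed
  have step: "r \<otimes> ((\<one> \<oplus> cr) \<otimes> cl) = (\<one> \<oplus> cr) \<otimes> cl \<otimes> (cr \<otimes> cl)"
  proof -
    have "(\<one> \<oplus> cr) \<otimes> cl \<otimes> ((\<one> \<oplus> cr) \<otimes> cl)
        = (\<one> \<oplus> cr) \<otimes> (cl \<otimes> cl) \<oplus> (\<one> \<oplus> cr) \<otimes> cl \<otimes> (cr \<otimes> cl)"
      using c by algebra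
    then show ?thesis using c by (simp add: r cl_cl)
  qed
  have rc: "r \<in> carrier R" using c by (simp add: r)
  have pow: "r [^] Suc k = (\<one> \<oplus> cr) \<otimes> cl \<otimes> (cr \<otimes> cl) [^] k" for k :: nat
  proof (induction k)
    case 0
    then show ?case using c rc by (simp add: r)
  next
    case (Suc k)
    have "r [^] Suc (Suc k) = r \<otimes> r [^] Suc k" by (rule nat_pow_Suc2[OF rc])
    also have "\<dots> = r \<otimes> ((\<one> \<oplus> cr) \<otimes> cl) \<otimes> (cr \<otimes> cl) [^] k"
      unfolding Suc using c rc by (simp add: m_assoc)
    also have "\<dots> = (\<one> \<oplus> cr) \<otimes> cl \<otimes> ((cr \<otimes> cl) \<otimes> (cr \<otimes> cl) [^] k)"
      unfolding step using c by (simp add: m_assoc)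
    also have "(cr \<otimes> cl) \<otimes> (cr \<otimes> cl) [^] k = (cr \<otimes> cl) [^] Suc k"
      using nat_pow_Suc2[of "cr \<otimes> cl" k] c by simp
    finally show ?case .
  qed
  show "r [^] n = (\<one> \<oplus> cr) \<otimes> cl \<otimes> (cr \<otimes> cl) [^] (n - 1)" if "n \<ge> 1"
    using pow[of "n - 1"] that by simp
qed

lemma (in ring) sandwich_mult_zero:
  assumes "a \<in> carrier R" "b \<in> carrier R" "c \<in> carrier R" "d \<in> carrier R" "t \<in> carrier R"
    and "b \<otimes> c = \<zero>"
  shows "(a \<otimes> t \<otimes> b) \<otimes> (c \<otimes> t \<otimes> d) = \<zero>"
proof -
  have "(a \<otimes> t \<otimes> b) \<otimes> (c \<otimes> t \<otimes> d) = a \<otimes> t \<otimes> (b \<otimes> c) \<otimes> (t \<otimes> d)"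
    using assms(1-5) by (simp add: m_assoc)
  then show ?thesis using assms by simp
qed

section \<open>The ring of matrices of operators\<close>

text \<open>
  Entries are compared as elements of spaces of distributions; evaluating sums of distributions at
  test functions would hide the linear structure from the simplifier.
\<close>

declare plus_fun_apply [simp del] zero_fun_apply [simp del]

lemma dist_subspace_closed:
  assumes "dist_subspace X"
  shows "0 \<in> X" "u \<in> X \<Longrightarrow> v \<in> X \<Longrightarrow> u + v \<in> X" "u \<in> X \<Longrightarrow> dist_scale c u \<in> X"
    "u \<in> X \<Longrightarrow> - u \<in> X"
proof -
  show "0 \<in> X" "u \<in> X \<Longrightarrow> v \<in> X \<Longrightarrow> u + v \<in> X" and *: "u \<in> X \<Longrightarrow> dist_scale c u \<in> X" for c
    using assms unfolding dist_subspace_def by auto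
  have "- u = dist_scale (- 1) u" by (auto simp: dist_scale_def)
  then show "u \<in> X \<Longrightarrow> - u \<in> X" using * by simp
qed

lemma dist_subspace_sum:
  assumes "dist_subspace X" "\<And>s. s \<in> S \<Longrightarrow> f s \<in> X"
  shows "sum f S \<in> X"
  using assms(2) by (induction S rule: infinite_finite_induct)
    (auto simp: dist_subspace_closed[OF assms(1)])

lemma dist_scale_add: "dist_scale c (u + v) = dist_scale c u + dist_scale c v"
  by (auto simp: dist_scale_def plus_fun_apply algebra_simps)

lemma dist_scale_zero: "dist_scale c 0 = 0"
  by (auto simp: dist_scale_def zero_fun_apply)

lemma dist_scale_sum: "dist_scale c (sum f S) = (\<Sum>s\<in>S. dist_scale c (f s))"
  by (induction S rule: infinite_finite_induct) (auto simp: dist_scale_add dist_scale_zero)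

lemma linear_on_space_zero:
  assumes "linear_on_space X T" "dist_subspace X"
  shows "T 0 = 0"
proof -
  have "T (0 + 0) = T 0 + T 0"
    using assms dist_subspace_closed(1)[OF assms(2)] unfolding linear_on_space_def by blast
  then show ?thesis by simp
qed

lemma linear_on_space_sum:
  assumes "linear_on_space X T" "dist_subspace X" "\<And>s. s \<in> S \<Longrightarrow> f s \<in> X"
  shows "T (sum f S) = (\<Sum>s\<in>S. T (f s))"
  using assms(3)
proof (induction S rule: infinite_finite_induct)
  case (insert x F)
  then have "sum f F \<in> X" "f x \<in> X" using dist_subspace_sum[OF assms(2), of F f] by auto
  then have "T (f x + sum f F) = T (f x) + T (sum f F)"
    using assms(1) unfolding linear_on_space_def by blast
  then show ?case using insert by simp
qed (simp_all add: linear_on_space_zero[OF assms(1,2)])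

lemma linear_operatorsI:
  assumes "\<And>u v. u \<in> X \<Longrightarrow> v \<in> X \<Longrightarrow> T (u + v) = T u + T v"
    and "\<And>c u. u \<in> X \<Longrightarrow> T (dist_scale c u) = dist_scale c (T u)"
    and "\<And>u. u \<in> X \<Longrightarrow> T u \<in> Y" and "\<And>u. u \<notin> X \<Longrightarrow> T u = 0"
  shows "T \<in> linear_operators X Y"
  using assms unfolding linear_operators_def linear_on_space_def by blast

locale operator_matrices =
  fixes m :: nat and X :: "nat \<Rightarrow> dist set"
  assumes subspace: "p \<in> {1..m} \<Longrightarrow> dist_subspace (X p)"
begin

abbreviation "R \<equiv> opmat_ring m X"

lemma ring_ops:
  "A \<otimes>\<^bsub>R\<^esub> B = (\<lambda>p q h. \<Sum>s\<in>{1..m}. A p s (B s q h))"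
  "A \<oplus>\<^bsub>R\<^esub> B = A + B" "\<one>\<^bsub>R\<^esub> = diag_opmat X {1..m}" "\<zero>\<^bsub>R\<^esub> = 0"
  by (simp_all add: opmat_ring_def)

lemma carrier_iff:
  "A \<in> carrier R \<longleftrightarrow> (\<forall>p q. if p \<in> {1..m} \<and> q \<in> {1..m}
     then A p q \<in> linear_operators (X q) (X p) else A p q = 0)"
  by (simp add: opmat_ring_def)

lemma carrierI:
  assumes "\<And>p q. p \<in> {1..m} \<Longrightarrow> q \<in> {1..m} \<Longrightarrow> A p q \<in> linear_operators (X q) (X p)"
    and "\<And>p q h. \<not> (p \<in> {1..m} \<and> q \<in> {1..m}) \<Longrightarrow> A p q h = 0"
  shows "A \<in> carrier R"
  proof -
  have "A p q = 0" if "\<not> (p \<in> {1..m} \<and> q \<in> {1..m})" for p q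
    by (rule ext) (simp add: assms(2)[OF that] zero_fun_apply)
  then show ?thesis using assms(1) unfolding carrier_iff by presburger
qed

lemma carrierD:
  assumes "A \<in> carrier R"
  shows "\<not> (p \<in> {1..m} \<and> q \<in> {1..m}) \<Longrightarrow> A p q = 0"
    and "p \<in> {1..m} \<Longrightarrow> q \<in> {1..m} \<Longrightarrow> linear_on_space (X q) (A p q)"
    and "p \<in> {1..m} \<Longrightarrow> q \<in> {1..m} \<Longrightarrow> h \<notin> X q \<Longrightarrow> A p q h = 0"
  using assms unfolding carrier_iff linear_operators_def by (metis (mono_tags, lifting) mem_Collect_eq)+

text \<open>The argument may lie outside the column space: the extension by \<open>0\<close> stays in the row space.\<close>

lemma entry_in_space:
  assumes "A \<in> carrier R" "p \<in> {1..m}"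
  shows "A p q h \<in> X p"
proof (cases "q \<in> {1..m} \<and> h \<in> X q")
  case True
  then have "A p q \<in> linear_operators (X q) (X p)"
    using assms unfolding carrier_iff by meson
  then show ?thesis using True unfolding linear_operators_def by blast
next
  case False
  then have "A p q h = 0" using carrierD(1,3)[OF assms(1)] assms(2) by (metis zero_fun_def)
  then show ?thesis using dist_subspace_closed(1)[OF subspace[OF assms(2)]] by simp
qed

lemma entry_zero:
  assumes "A \<in> carrier R"
  shows "A p q 0 = 0"
proof (cases "p \<in> {1..m} \<and> q \<in> {1..m}")
  case True
  then show ?thesis using carrierD(2)[OF assms] linear_on_space_zero subspace by blast
next
  case False
  then show ?thesis using carrierD(1)[OF assms] by (metis zero_fun_def)
qed

lemma entry_add:
  assumes "A \<in> carrier R" "p \<in> {1..m}" "q \<in> {1..m}" "u \<in> X q" "v \<in> X q"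
  shows "A p q (u + v) = A p q u + A p q v"
  using carrierD(2)[OF assms(1-3)] assms(4,5) unfolding linear_on_space_def by blast

lemma entry_scale:
  assumes "A \<in> carrier R" "p \<in> {1..m}" "q \<in> {1..m}" "u \<in> X q"
  shows "A p q (dist_scale c u) = dist_scale c (A p q u)"
  using carrierD(2)[OF assms(1-3)] assms(4) unfolding linear_on_space_def by blast

lemma entry_sum:
  assumes "A \<in> carrier R" "p \<in> {1..m}" "q \<in> {1..m}" "\<And>s. s \<in> S \<Longrightarrow> f s \<in> X q"
  shows "A p q (sum f S) = (\<Sum>s\<in>S. A p q (f s))"
  using linear_on_space_sum carrierD(2)[OF assms(1-3)] subspace[OF assms(3)] assms(4) by metis

lemma diag_closed: "P \<subseteq> {1..m} \<Longrightarrow> diag_opmat X P \<in> carrier R"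
  by (rule carrierI)
     (auto simp: diag_opmat_def linear_operators_def linear_on_space_def dist_scale_zero
       dist_subspace_closed subspace)

lemma diag_mult_entry:
  assumes "A \<in> carrier R" "P \<subseteq> {1..m}"
  shows "(diag_opmat X P \<otimes>\<^bsub>R\<^esub> A) p q h = (if p \<in> P then A p q h else 0)"
proof -
  have "(diag_opmat X P \<otimes>\<^bsub>R\<^esub> A) p q h = (\<Sum>s\<in>{1..m}. if p = s then (if p \<in> P then A p q h else 0) else 0)"
    unfolding ring_ops using entry_in_space[OF assms(1)]
    by (intro sum.cong) (auto simp: diag_opmat_def)
  also have "\<dots> = (if p \<in> P then A p q h else 0)"
    using assms(2) by (subst sum.delta') auto
  finally show ?thesis .
qed

lemma mult_diag_entry:
  assumes "A \<in> carrier R" "P \<subseteq> {1..m}"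
  shows "(A \<otimes>\<^bsub>R\<^esub> diag_opmat X P) p q h = (if q \<in> P then A p q h else 0)"
proof (cases "p \<in> {1..m}")
  case True
  have "(A \<otimes>\<^bsub>R\<^esub> diag_opmat X P) p q h = (\<Sum>s\<in>{1..m}. if s = q then (if q \<in> P then A p q h else 0) else 0)"
    unfolding ring_ops using carrierD(3)[OF assms(1) True] entry_zero[OF assms(1)]
    by (intro sum.cong) (auto simp: diag_opmat_def)
  also have "\<dots> = (if q \<in> P then A p q h else 0)"
    using assms(2) by (subst sum.delta) auto
  finally show ?thesis .
next
  case False
  then have "A p s = 0" for s using carrierD(1)[OF assms(1)] by blast
  then show ?thesis by (simp add: ring_ops zero_fun_apply)
qed

lemma add_closed:
  assumes "A \<in> carrier R" "B \<in> carrier R"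
  shows "A + B \<in> carrier R"
proof (rule carrierI)
  fix p q assume pq: "p \<in> {1..m}" "q \<in> {1..m}"
  have "(A + B) p q h = A p q h + B p q h" for h by (simp only: plus_fun_apply)
  then show "(A + B) p q \<in> linear_operators (X q) (X p)"
    by (intro linear_operatorsI)
       (simp_all add: entry_add[OF assms(1) pq] entry_add[OF assms(2) pq]
         entry_scale[OF assms(1) pq] entry_scale[OF assms(2) pq]
         carrierD(3)[OF assms(1) pq] carrierD(3)[OF assms(2) pq]
         entry_in_space[OF assms(1) pq(1)] entry_in_space[OF assms(2) pq(1)]
         dist_subspace_closed(2)[OF subspace[OF pq(1)]] dist_scale_add ac_simps)
next
  fix p q h assume "\<not> (p \<in> {1..m} \<and> q \<in> {1..m})"
  then have "A p q = 0" "B p q = 0"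
    using carrierD(1)[OF assms(1)] carrierD(1)[OF assms(2)] by blast+
  then show "(A + B) p q h = 0" by (simp add: plus_fun_apply zero_fun_apply)
qed

lemma zero_closed: "0 \<in> carrier R"
  unfolding carrier_iff linear_operators_def linear_on_space_def
  by (auto simp: zero_fun_apply dist_scale_zero dist_subspace_closed subspace)

lemma uminus_closed:
  assumes "A \<in> carrier R"
  shows "- A \<in> carrier R"
proof (rule carrierI)
  have scale: "- dist_scale c u = dist_scale c (- u)" for c u by (auto simp: dist_scale_def)
  fix p q assume pq: "p \<in> {1..m}" "q \<in> {1..m}"
  show "(- A) p q \<in> linear_operators (X q) (X p)"
    by (rule linear_operatorsI)
       (simp_all add: entry_add[OF assms pq] entry_scale[OF assms pq] carrierD(3)[OF assms pq]
         entry_in_space[OF assms pq(1)] dist_subspace_closed(4)[OF subspace[OF pq(1)]] scale)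
next
  fix p q h assume "\<not> (p \<in> {1..m} \<and> q \<in> {1..m})"
  then have "A p q = 0" using carrierD(1)[OF assms] by blast
  then show "(- A) p q h = 0" by (simp add: zero_fun_apply)
qed

lemma mult_closed:
  assumes "A \<in> carrier R" "B \<in> carrier R"
  shows "A \<otimes>\<^bsub>R\<^esub> B \<in> carrier R"
proof (rule carrierI)
  fix p q h assume "\<not> (p \<in> {1..m} \<and> q \<in> {1..m})"
  then have "(\<forall>s. A p s = 0) \<or> (\<forall>s. B s q = 0)"
    using carrierD(1)[OF assms(1)] carrierD(1)[OF assms(2)] by blast
  then show "(A \<otimes>\<^bsub>R\<^esub> B) p q h = 0"
    by (auto simp: ring_ops zero_fun_apply entry_zero[OF assms(1)])
next
  fix p q assume pq: "p \<in> {1..m}" "q \<in> {1..m}"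
  have "(A \<otimes>\<^bsub>R\<^esub> B) p q (u + v) = (A \<otimes>\<^bsub>R\<^esub> B) p q u + (A \<otimes>\<^bsub>R\<^esub> B) p q v"
    if "u \<in> X q" "v \<in> X q" for u v
    unfolding ring_ops sum.distrib[symmetric] using that pq
    by (intro sum.cong) (simp_all add: entry_add assms entry_in_space)
  moreover have "(A \<otimes>\<^bsub>R\<^esub> B) p q (dist_scale c u) = dist_scale c ((A \<otimes>\<^bsub>R\<^esub> B) p q u)"
    if "u \<in> X q" for c u
    unfolding ring_ops dist_scale_sum
  proof (rule sum.cong)
    fix s assume s: "s \<in> {1..m}"
    show "A p s (B s q (dist_scale c u)) = dist_scale c (A p s (B s q u))"
      using entry_scale[OF assms(2) s pq(2) that] entry_scale[OF assms(1) pq(1) s]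
        entry_in_space[OF assms(2) s] by simp
  qed simp
  moreover have "(A \<otimes>\<^bsub>R\<^esub> B) p q u \<in> X p" for u
    unfolding ring_ops using pq entry_in_space[OF assms(1)] subspace
    by (intro dist_subspace_sum) auto
  moreover have "(A \<otimes>\<^bsub>R\<^esub> B) p q u = 0" if "u \<notin> X q" for u
    unfolding ring_ops using that pq
    by (intro sum.neutral ballI) (simp add: carrierD(3)[OF assms(2)] entry_zero[OF assms(1)])
  ultimately show "(A \<otimes>\<^bsub>R\<^esub> B) p q \<in> linear_operators (X q) (X p)"
    by (rule linear_operatorsI)
qed

text \<open>
  A product composes entries, so left distributivity holds by definition, whereas associativity and
  right distributivity move an entry through a sum and rest on its linearity on the middle space.
\<close>

lemma mult_assoc:
  assumes "A \<in> carrier R" "B \<in> carrier R" "C \<in> carrier R"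
  shows "A \<otimes>\<^bsub>R\<^esub> B \<otimes>\<^bsub>R\<^esub> C = A \<otimes>\<^bsub>R\<^esub> (B \<otimes>\<^bsub>R\<^esub> C)"
proof (intro ext)
  fix p q h \<phi>
  show "(A \<otimes>\<^bsub>R\<^esub> B \<otimes>\<^bsub>R\<^esub> C) p q h \<phi> = (A \<otimes>\<^bsub>R\<^esub> (B \<otimes>\<^bsub>R\<^esub> C)) p q h \<phi>"
  proof (cases "p \<in> {1..m}")
    case True
    have "(A \<otimes>\<^bsub>R\<^esub> (B \<otimes>\<^bsub>R\<^esub> C)) p q h
        = (\<Sum>s\<in>{1..m}. \<Sum>t\<in>{1..m}. A p s (B s t (C t q h)))"
      unfolding ring_ops by (intro sum.cong) (auto intro!: entry_sum[OF assms(1) True] entry_in_space[OF assms(2)])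
    also have "\<dots> = (A \<otimes>\<^bsub>R\<^esub> B \<otimes>\<^bsub>R\<^esub> C) p q h"
      unfolding ring_ops by (rule sum.swap)
    finally show ?thesis by simp
  next
    case False
    then have "A p s = 0" for s using carrierD(1)[OF assms(1)] by blast
    then show ?thesis by (simp add: ring_ops zero_fun_apply)
  qed
qed

lemma mult_add_right:
  assumes "A \<in> carrier R" "B \<in> carrier R" "C \<in> carrier R"
  shows "A \<otimes>\<^bsub>R\<^esub> (B \<oplus>\<^bsub>R\<^esub> C) = A \<otimes>\<^bsub>R\<^esub> B \<oplus>\<^bsub>R\<^esub> A \<otimes>\<^bsub>R\<^esub> C"
proof (intro ext)
  fix p q h \<phi>
  show "(A \<otimes>\<^bsub>R\<^esub> (B \<oplus>\<^bsub>R\<^esub> C)) p q h \<phi> = (A \<otimes>\<^bsub>R\<^esub> B \<oplus>\<^bsub>R\<^esub> A \<otimes>\<^bsub>R\<^esub> C) p q h \<phi>"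
  proof (cases "p \<in> {1..m}")
    case True
    have entry: "(B \<oplus>\<^bsub>R\<^esub> C) s q h = B s q h + C s q h" for s
      by (simp only: ring_ops plus_fun_apply)
    have "(A \<otimes>\<^bsub>R\<^esub> (B \<oplus>\<^bsub>R\<^esub> C)) p q h = (\<Sum>s\<in>{1..m}. A p s (B s q h) + A p s (C s q h))"
      unfolding ring_ops(1) using True entry
      by (intro sum.cong) (simp_all add: entry_add assms entry_in_space)
    also have "\<dots> = (A \<otimes>\<^bsub>R\<^esub> B \<oplus>\<^bsub>R\<^esub> A \<otimes>\<^bsub>R\<^esub> C) p q h"
      by (simp add: ring_ops plus_fun_apply sum.distrib)
    finally show ?thesis by simp
  next
    case False
    then have "A p s = 0" for s using carrierD(1)[OF assms(1)] by blast
    then show ?thesis by (simp add: ring_ops plus_fun_apply zero_fun_apply)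
  qed
qed

sublocale ring R
proof (rule ringI)
  show "abelian_group R"
  proof (rule abelian_groupI)
    fix A assume "A \<in> carrier R"
    then show "\<exists>B\<in>carrier R. B \<oplus>\<^bsub>R\<^esub> A = \<zero>\<^bsub>R\<^esub>"
      by (intro bexI[of _ "- A"]) (auto simp: ring_ops uminus_closed)
  qed (auto simp: ring_ops add_closed zero_closed add.assoc add.commute)
  show "monoid R"
  proof (rule monoidI)
    fix A assume A: "A \<in> carrier R"
    then have out: "p \<notin> {1..m} \<or> q \<notin> {1..m} \<Longrightarrow> A p q h = 0" for p q h
      using carrierD(1) by (metis zero_fun_def)
    show "\<one>\<^bsub>R\<^esub> \<otimes>\<^bsub>R\<^esub> A = A"
    proof (intro ext)
      fix p q h \<phi>
      show "(\<one>\<^bsub>R\<^esub> \<otimes>\<^bsub>R\<^esub> A) p q h \<phi> = A p q h \<phi>"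
        unfolding ring_ops(3) diag_mult_entry[OF A order_refl] using out[of p q h] by auto
    qed
    show "A \<otimes>\<^bsub>R\<^esub> \<one>\<^bsub>R\<^esub> = A"
    proof (intro ext)
      fix p q h \<phi>
      show "(A \<otimes>\<^bsub>R\<^esub> \<one>\<^bsub>R\<^esub>) p q h \<phi> = A p q h \<phi>"
        unfolding ring_ops(3) mult_diag_entry[OF A order_refl] using out[of p q h] by auto
    qed
  qed (auto simp: mult_closed mult_assoc diag_closed ring_ops(3))
  fix A B C assume "A \<in> carrier R" "B \<in> carrier R" "C \<in> carrier R"
  then show "C \<otimes>\<^bsub>R\<^esub> (A \<oplus>\<^bsub>R\<^esub> B) = C \<otimes>\<^bsub>R\<^esub> A \<oplus>\<^bsub>R\<^esub> C \<otimes>\<^bsub>R\<^esub> B"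
    by (simp add: mult_add_right)
  show "(A \<oplus>\<^bsub>R\<^esub> B) \<otimes>\<^bsub>R\<^esub> C = A \<otimes>\<^bsub>R\<^esub> C \<oplus>\<^bsub>R\<^esub> B \<otimes>\<^bsub>R\<^esub> C"
    by (intro ext) (simp add: ring_ops plus_fun_apply sum.distrib)
qed

lemma transpose_diag: "opmat_transpose (diag_opmat X P) = diag_opmat X P"
  by (auto simp: opmat_transpose_def diag_opmat_def fun_eq_iff)

lemma diag_mult_disjoint:
  assumes "P \<subseteq> {1..m}" "Q \<subseteq> {1..m}" "P \<inter> Q = {}"
  shows "diag_opmat X P \<otimes>\<^bsub>R\<^esub> diag_opmat X Q = \<zero>\<^bsub>R\<^esub>"
proof (intro ext)
  fix p q h \<phi>
  show "(diag_opmat X P \<otimes>\<^bsub>R\<^esub> diag_opmat X Q) p q h \<phi> = \<zero>\<^bsub>R\<^esub> p q h \<phi>"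
    unfolding diag_mult_entry[OF diag_closed[OF assms(2)] assms(1)] using assms(3)
    by (auto simp: diag_opmat_def ring_ops zero_fun_apply)
qed

lemma diag_add_complement:
  assumes "P \<inter> Q = {}" "P \<union> Q = {1..m}"
  shows "diag_opmat X P \<oplus>\<^bsub>R\<^esub> diag_opmat X Q = \<one>\<^bsub>R\<^esub>"
  unfolding ring_ops assms(2)[symmetric] using assms(1)
  by (auto simp: diag_opmat_def fun_eq_iff plus_fun_apply zero_fun_apply)

text \<open>Each further factor moves the support at least one more diagonal down, until it leaves the matrix.\<close>

lemma strictly_lower_power:
  assumes A: "A \<in> carrier R" and low: "\<And>p q. p \<le> q \<Longrightarrow> A p q = 0"
  shows "p < q + k \<Longrightarrow> (A [^]\<^bsub>R\<^esub> (k::nat)) p q = 0"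
proof (induction k arbitrary: p q)
  case 0
  then show ?case by (auto simp: ring_ops diag_opmat_def fun_eq_iff zero_fun_apply)
next
  case (Suc k)
  have P: "A [^]\<^bsub>R\<^esub> k \<in> carrier R" using A by simp
  have "(A [^]\<^bsub>R\<^esub> k) p s (A s q h) = 0" for s h
  proof (cases "s \<le> q")
    case True
    then show ?thesis using entry_zero[OF P] by (simp add: low zero_fun_apply)
  next
    case False
    then have "(A [^]\<^bsub>R\<^esub> k) p s = 0" using Suc by simp
    then show ?thesis by (simp add: zero_fun_apply)
  qed
  then have "(A [^]\<^bsub>R\<^esub> Suc k) p q h = 0" for h by (simp add: ring_ops(1))
  then show ?case by (intro ext) (simp add: zero_fun_apply)
qed

lemma one_minus_strictly_lower_unit:
  assumes A: "A \<in> carrier R" and low: "\<And>p q. p \<le> q \<Longrightarrow> A p q = 0"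
  shows "\<one>\<^bsub>R\<^esub> \<ominus>\<^bsub>R\<^esub> A \<in> Units R"
proof (rule one_minus_nilpotent_unit[OF A])
  show "A [^]\<^bsub>R\<^esub> m = \<zero>\<^bsub>R\<^esub>"
  proof (intro ext)
    fix p q
    have "(A [^]\<^bsub>R\<^esub> m) p q = 0"
    proof (cases "p \<in> {1..m} \<and> q \<in> {1..m}")
      case True
      then show ?thesis by (intro strictly_lower_power[OF A low]) auto
    next
      case False
      then show ?thesis using carrierD(1) A nat_pow_closed by blast
    qed
    then show "(A [^]\<^bsub>R\<^esub> m) p q h \<phi> = \<zero>\<^bsub>R\<^esub> p q h \<phi>" for h \<phi> by (simp add: ring_ops zero_fun_apply)
  qed
qed

end

section \<open>Linearity of the local solution operators\<close>

lemma helmholtz_add: "helmholtz k U (u + v) = helmholtz k U u + helmholtz k U v"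
  by (auto simp: helmholtz_def fun_eq_iff plus_fun_apply)

lemma helmholtz_scale: "helmholtz k U (dist_scale c u) = dist_scale c (helmholtz k U u)"
  by (auto simp: helmholtz_def dist_scale_def fun_eq_iff)

locale strips =
  fixes D :: strip_ddm
  assumes decomposition: "strip_decomposition D"
begin

abbreviation "N \<equiv> num_strips D"

lemma N_ge_2: "2 \<le> N"
  using decomposition unfolding strip_decomposition_def strip_geometry_def Let_def by blast

lemma field_space:
  assumes "i \<in> {1..N}"
  shows "dist_subspace (field_space D i)" "dist_subspace (source_space D i)"
    "linear_on_space (field_space D i) (physical_bc D i)"
  using assms decomposition unfolding strip_decomposition_def strip_operators_def by auto

lemma interface_space:
  assumes "p \<in> interface_indices N"
  shows "dist_subspace (interface_space D p)"
    "j \<in> {fst p, neighbour p} \<Longrightarrow> linear_on_space (field_space D j) (interface_op D p j)"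
    "j \<in> {fst p, neighbour p} \<Longrightarrow> v \<in> field_space D j \<Longrightarrow> interface_op D p j v \<in> interface_space D p"
  using assms decomposition unfolding strip_decomposition_def strip_operators_def by blast+

lemma index_iff:
  "(i, Lft) \<in> interface_indices N \<longleftrightarrow> 2 \<le> i \<and> i \<le> N"
  "(i, Rgt) \<in> interface_indices N \<longleftrightarrow> 1 \<le> i \<and> i \<le> N - 1"
  by (auto simp: interface_indices_def)

lemma is_local_solution_add:
  assumes i: "i \<in> {1..N}" and "is_local_solution D i hl hr f v" "is_local_solution D i hl' hr' f' v'"
  shows "is_local_solution D i (hl + hl') (hr + hr') (f + f') (v + v')"
proof -
  have "2 \<le> i \<Longrightarrow> linear_on_space (field_space D i) (interface_op D (i, Lft) i)"
    and "i \<le> N - 1 \<Longrightarrow> linear_on_space (field_space D i) (interface_op D (i, Rgt) i)"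
    using i by (auto intro!: interface_space(2) simp: index_iff)
  then show ?thesis
    using assms(2,3) field_space[OF i] unfolding is_local_solution_def linear_on_space_def
    by (auto simp: helmholtz_add dist_subspace_closed)
qed

lemma is_local_solution_scale:
  assumes i: "i \<in> {1..N}" and "is_local_solution D i hl hr f v"
  shows "is_local_solution D i (dist_scale c hl) (dist_scale c hr) (dist_scale c f) (dist_scale c v)"
proof -
  have "2 \<le> i \<Longrightarrow> linear_on_space (field_space D i) (interface_op D (i, Lft) i)"
    and "i \<le> N - 1 \<Longrightarrow> linear_on_space (field_space D i) (interface_op D (i, Rgt) i)"
    using i by (auto intro!: interface_space(2) simp: index_iff)
  then show ?thesis
    using assms(2) field_space[OF i] unfolding is_local_solution_def linear_on_space_def
    by (auto simp: helmholtz_scale dist_subspace_closed dist_scale_zero)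
qed

definition admissible :: "nat \<Rightarrow> dist \<Rightarrow> dist \<Rightarrow> bool" where
  "admissible i hl hr \<longleftrightarrow> (2 \<le> i \<longrightarrow> hl \<in> interface_space D (i, Lft)) \<and>
     (i \<le> N - 1 \<longrightarrow> hr \<in> interface_space D (i, Rgt))"

lemma local_solve_unique:
  assumes "i \<in> {1..N}" "admissible i hl hr"
  shows "\<exists>!v. is_local_solution D i hl hr 0 v"
  using assms dist_subspace_closed(1)[OF field_space(2)[OF assms(1)]] decomposition
  unfolding strip_decomposition_def locally_well_posed_def admissible_def by blast

lemma local_solve_solution:
  assumes "i \<in> {1..N}" "admissible i hl hr"
  shows "is_local_solution D i hl hr 0 (local_solve D i hl hr 0)"
  unfolding local_solve_def by (rule theI'[OF local_solve_unique[OF assms]])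

lemma local_solve_eqI:
  assumes "i \<in> {1..N}" "admissible i hl hr" "is_local_solution D i hl hr 0 v"
  shows "local_solve D i hl hr 0 = v"
  using local_solve_unique[OF assms(1,2)] local_solve_solution[OF assms(1,2)] assms(3) by blast

lemma local_solve_in_field_space:
  assumes "i \<in> {1..N}" "admissible i hl hr"
  shows "local_solve D i hl hr 0 \<in> field_space D i"
  using local_solve_solution[OF assms] unfolding is_local_solution_def by blast

lemma admissible_add:
  "i \<in> {1..N} \<Longrightarrow> admissible i hl hr \<Longrightarrow> admissible i hl' hr' \<Longrightarrow> admissible i (hl + hl') (hr + hr')"
  unfolding admissible_def by (auto simp: index_iff interface_space(1) dist_subspace_closed(2))

lemma admissible_scale:
  "i \<in> {1..N} \<Longrightarrow> admissible i hl hr \<Longrightarrow> admissible i (dist_scale c hl) (dist_scale c hr)"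
  unfolding admissible_def by (auto simp: index_iff interface_space(1) dist_subspace_closed(3))

lemma admissible_one_sided:
  assumes "i \<in> {1..N}"
  shows "h \<in> interface_space D (i, Lft) \<Longrightarrow> admissible i h 0"
    "h \<in> interface_space D (i, Rgt) \<Longrightarrow> admissible i 0 h"
  using assms unfolding admissible_def
  by (auto simp: index_iff interface_space(1) dist_subspace_closed(1))

lemma local_solve_add:
  assumes i: "i \<in> {1..N}" and "admissible i hl hr" "admissible i hl' hr'"
  shows "local_solve D i (hl + hl') (hr + hr') 0 = local_solve D i hl hr 0 + local_solve D i hl' hr' 0"
  using is_local_solution_add[OF i local_solve_solution[OF i assms(2)] local_solve_solution[OF i assms(3)]]
    admissible_add[OF assms] by (intro local_solve_eqI[OF i]) simp_all

lemma local_solve_scale: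
  assumes i: "i \<in> {1..N}" and "admissible i hl hr"
  shows "local_solve D i (dist_scale c hl) (dist_scale c hr) 0 = dist_scale c (local_solve D i hl hr 0)"
  using is_local_solution_scale[OF i local_solve_solution[OF assms], of c] admissible_scale[OF assms]
  by (intro local_solve_eqI[OF i]) (simp_all add: dist_scale_zero)

lemma local_solve_linear:
  assumes i: "i \<in> {1..N}"
  shows "linear_on_space (interface_space D (i, Lft)) (\<lambda>h. local_solve D i h 0 0)"
    and "linear_on_space (interface_space D (i, Rgt)) (\<lambda>h. local_solve D i 0 h 0)"
  unfolding linear_on_space_def
  using local_solve_add[OF i, where hr = 0 and hr' = 0] local_solve_scale[OF i, where hr = 0]
    local_solve_add[OF i, where hl = 0 and hl' = 0] local_solve_scale[OF i, where hl = 0]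
    admissible_one_sided[OF i]
  by (simp_all add: dist_scale_zero)

text \<open>
  A nonzero entry is a local solution operator on the strip of its column, followed by the operator of
  an interface whose neighbouring strip is that one.
\<close>

lemma transmission_linear:
  assumes r: "r \<in> interface_indices N" and c: "c \<in> interface_indices N"
  shows "linear_on_space (interface_space D c) (transmission D r c)"
    and "h \<in> interface_space D c \<Longrightarrow> transmission D r c h \<in> interface_space D r"
proof -
  let ?i = "fst c"
  have i: "?i \<in> {1..N}" using c N_ge_2 by (auto simp: interface_indices_def)
  define S where "S = (\<lambda>h. if snd c = Lft then local_solve D ?i h 0 0 else local_solve D ?i 0 h 0)"
  have S_lin: "linear_on_space (interface_space D c) S"
    and S_in: "h \<in> interface_space D c \<Longrightarrow> S h \<in> field_space D ?i" for h
    using local_solve_linear[OF i] admissible_one_sided[OF i] local_solve_in_field_space[OF i]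
    by (cases c; cases "snd c"; simp add: S_def)+
  have "(\<forall>h. transmission D r c h = 0) \<or>
      (?i = neighbour r \<and> (\<forall>h. transmission D r c h = interface_op D r ?i (S h)))"
    by (cases c; cases "snd c") (auto simp: transmission_def S_def Let_def)
  then have "linear_on_space (interface_space D c) (transmission D r c) \<and>
      (\<forall>h\<in>interface_space D c. transmission D r c h \<in> interface_space D r)"
  proof
    assume "\<forall>h. transmission D r c h = 0"
    then show ?thesis
      unfolding linear_on_space_def
      by (simp add: dist_scale_zero dist_subspace_closed(1)[OF interface_space(1)[OF r]])
  next
    assume *: "?i = neighbour r \<and> (\<forall>h. transmission D r c h = interface_op D r ?i (S h))"
    then have "linear_on_space (field_space D ?i) (interface_op D r ?i)"
      and "v \<in> field_space D ?i \<Longrightarrow> interface_op D r ?i v \<in> interface_space D r" for v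
      using interface_space(2,3)[OF r] by auto
    then show ?thesis using * S_lin S_in unfolding linear_on_space_def by simp
  qed
  then show "linear_on_space (interface_space D c) (transmission D r c)"
    and "h \<in> interface_space D c \<Longrightarrow> transmission D r c h \<in> interface_space D r" by auto
qed

section \<open>The substructured operator and its blocks\<close>

lemma LR_index_in: "p \<in> {1..2 * N - 2} \<Longrightarrow> LR_index N p \<in> interface_indices N"
  using N_ge_2 by (auto simp: LR_index_def interface_indices_def)

sublocale operator_matrices "2 * N - 2" "LR_space D"
  by unfold_locales (simp add: LR_space_def interface_space(1) LR_index_in)

lemma LR_ring_eq: "LR_ring D = R"
  by (simp add: LR_ring_def)

lemma T_LR_closed: "T_LR D \<in> carrier R"
proof (rule carrierI)
  fix p q assume pq: "p \<in> {1..2 * N - 2}" "q \<in> {1..2 * N - 2}"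
  note r = LR_index_in[OF pq(1)] and c = LR_index_in[OF pq(2)]
  have sub: "dist_subspace (LR_space D q)" using subspace pq(2) by blast
  have T: "T_LR D p q h = (if h \<in> LR_space D q
      then transmission D (LR_index N p) (LR_index N q) h else 0)" for h
    using pq by (simp add: T_LR_def Let_def)
  show "T_LR D p q \<in> linear_operators (LR_space D q) (LR_space D p)"
  proof (rule linear_operatorsI)
    fix u v c assume "u \<in> LR_space D q" "v \<in> LR_space D q"
    then show "T_LR D p q (u + v) = T_LR D p q u + T_LR D p q v"
      and "T_LR D p q (dist_scale c u) = dist_scale c (T_LR D p q u)"
      and "T_LR D p q u \<in> LR_space D p"
      using transmission_linear[OF r c] dist_subspace_closed(2,3)[OF sub]
      unfolding T linear_on_space_def LR_space_def by simp_all
  qed (simp add: T)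
qed (auto simp: T_LR_def Let_def)

text \<open>
  Within one side, transmission only goes from an interface to the next one in the direction
  of travel, which is the next position in left-right numbering.
\<close>

lemma T_LR_lower:
  assumes "p \<le> q" "q \<le> N - 1 \<or> N \<le> p"
  shows "T_LR D p q = 0"
proof -
  have "transmission D (LR_index N p) (LR_index N q) h = 0"
    if "p \<in> {1..2 * N - 2}" "q \<in> {1..2 * N - 2}" for h
    using assms that N_ge_2 by (auto simp: transmission_def LR_index_def Let_def)
  then show ?thesis by (auto simp: T_LR_def Let_def fun_eq_iff zero_fun_apply)
qed

definition lpos where "lpos = {1..N - 1}"
definition rpos where "rpos = {N..2 * N - 2}"

lemma pos_facts:
  "lpos \<subseteq> {1..2 * N - 2}" "rpos \<subseteq> {1..2 * N - 2}" "lpos \<inter> rpos = {}" "rpos \<inter> lpos = {}"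
  "lpos \<union> rpos = {1..2 * N - 2}"
  using N_ge_2 by (auto simp: lpos_def rpos_def)

lemma I_eq: "I_l D = diag_opmat (LR_space D) lpos" "I_r D = diag_opmat (LR_space D) rpos"
  by (simp_all add: I_l_def I_r_def lpos_def rpos_def)

lemma I_closed: "I_l D \<in> carrier R" "I_r D \<in> carrier R"
  unfolding I_eq by (intro diag_closed pos_facts)+

lemma I_orthogonal: "I_l D \<otimes>\<^bsub>R\<^esub> I_r D = \<zero>\<^bsub>R\<^esub>" "I_r D \<otimes>\<^bsub>R\<^esub> I_l D = \<zero>\<^bsub>R\<^esub>"
  unfolding I_eq by (intro diag_mult_disjoint pos_facts)+

lemma I_sum: "I_l D \<oplus>\<^bsub>R\<^esub> I_r D = \<one>\<^bsub>R\<^esub>"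
  unfolding I_eq by (intro diag_add_complement pos_facts)

lemma block_eqs:
  "M_l D = I_l D \<otimes>\<^bsub>R\<^esub> T_LR D \<otimes>\<^bsub>R\<^esub> I_l D" "A_l D = I_l D \<otimes>\<^bsub>R\<^esub> T_LR D \<otimes>\<^bsub>R\<^esub> I_r D"
  "A_r D = I_r D \<otimes>\<^bsub>R\<^esub> T_LR D \<otimes>\<^bsub>R\<^esub> I_l D" "M_r D = I_r D \<otimes>\<^bsub>R\<^esub> T_LR D \<otimes>\<^bsub>R\<^esub> I_r D"
  by (simp_all add: M_l_def A_l_def A_r_def M_r_def LR_ring_eq I_eq transpose_diag)

lemma blocks_closed:
  "M_l D \<in> carrier R" "A_l D \<in> carrier R" "A_r D \<in> carrier R" "M_r D \<in> carrier R"
  unfolding block_eqs using I_closed T_LR_closed by simp_all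

lemma T_LR_blocks: "T_LR D = M_l D \<oplus>\<^bsub>R\<^esub> A_l D \<oplus>\<^bsub>R\<^esub> A_r D \<oplus>\<^bsub>R\<^esub> M_r D"
proof -
  have "T_LR D = (I_l D \<oplus>\<^bsub>R\<^esub> I_r D) \<otimes>\<^bsub>R\<^esub> T_LR D \<otimes>\<^bsub>R\<^esub> (I_l D \<oplus>\<^bsub>R\<^esub> I_r D)"
    using T_LR_closed by (simp add: I_sum)
  also have "\<dots> = M_l D \<oplus>\<^bsub>R\<^esub> A_l D \<oplus>\<^bsub>R\<^esub> A_r D \<oplus>\<^bsub>R\<^esub> M_r D"
    unfolding block_eqs using I_closed T_LR_closed by algebra
  finally show ?thesis .
qed

lemma diagonal_blocks_units:
  "\<one>\<^bsub>R\<^esub> \<ominus>\<^bsub>R\<^esub> M_l D \<in> Units R" "\<one>\<^bsub>R\<^esub> \<ominus>\<^bsub>R\<^esub> M_r D \<in> Units R"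
proof -
  have entry: "(diag_opmat (LR_space D) P \<otimes>\<^bsub>R\<^esub> T_LR D \<otimes>\<^bsub>R\<^esub> diag_opmat (LR_space D) P) p q h
      = (if p \<in> P \<and> q \<in> P then T_LR D p q h else 0)" if "P \<subseteq> {1..2 * N - 2}" for P p q h
    using that T_LR_closed diag_closed[OF that] by (simp add: mult_diag_entry diag_mult_entry)
  show "\<one>\<^bsub>R\<^esub> \<ominus>\<^bsub>R\<^esub> M_l D \<in> Units R"
  proof (rule one_minus_strictly_lower_unit[OF blocks_closed(1)])
    fix p q :: nat assume "p \<le> q"
    then have "M_l D p q h = 0" for h
      unfolding block_eqs I_eq entry[OF pos_facts(1)] using T_LR_lower[of p q] by (auto simp: lpos_def zero_fun_apply)
    then show "M_l D p q = 0" by (simp add: fun_eq_iff zero_fun_apply)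
  qed
  show "\<one>\<^bsub>R\<^esub> \<ominus>\<^bsub>R\<^esub> M_r D \<in> Units R"
  proof (rule one_minus_strictly_lower_unit[OF blocks_closed(4)])
    fix p q :: nat assume "p \<le> q"
    then have "M_r D p q h = 0" for h
      unfolding block_eqs I_eq entry[OF pos_facts(2)] using T_LR_lower[of p q] by (auto simp: rpos_def zero_fun_apply)
    then show "M_r D p q = 0" by (simp add: fun_eq_iff zero_fun_apply)
  qed
qed

lemma block_products:
  "M_l D \<otimes>\<^bsub>R\<^esub> M_r D = \<zero>\<^bsub>R\<^esub>" "M_l D \<otimes>\<^bsub>R\<^esub> A_r D = \<zero>\<^bsub>R\<^esub>"
  "A_l D \<otimes>\<^bsub>R\<^esub> M_l D = \<zero>\<^bsub>R\<^esub>" "A_l D \<otimes>\<^bsub>R\<^esub> A_l D = \<zero>\<^bsub>R\<^esub>"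
  "M_r D \<otimes>\<^bsub>R\<^esub> M_l D = \<zero>\<^bsub>R\<^esub>" "M_r D \<otimes>\<^bsub>R\<^esub> A_l D = \<zero>\<^bsub>R\<^esub>"
  "A_r D \<otimes>\<^bsub>R\<^esub> M_r D = \<zero>\<^bsub>R\<^esub>" "A_r D \<otimes>\<^bsub>R\<^esub> A_r D = \<zero>\<^bsub>R\<^esub>"
  unfolding block_eqs by (intro sandwich_mult_zero I_closed T_LR_closed I_orthogonal)+

end

theorem proposition4p4:
  fixes D :: strip_ddm
  assumes "strip_decomposition D"
  shows "R_BGS D = (\<one>\<^bsub>LR_ring D\<^esub> \<oplus>\<^bsub>LR_ring D\<^esub> C_r D) \<otimes>\<^bsub>LR_ring D\<^esub> C_l D \<and>
    (\<forall>n::nat. n \<ge> 1 \<longrightarrow>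
      R_BGS D [^]\<^bsub>LR_ring D\<^esub> n =
        (\<one>\<^bsub>LR_ring D\<^esub> \<oplus>\<^bsub>LR_ring D\<^esub> C_r D) \<otimes>\<^bsub>LR_ring D\<^esub> C_l D
          \<otimes>\<^bsub>LR_ring D\<^esub> (C_r D \<otimes>\<^bsub>LR_ring D\<^esub> C_l D) [^]\<^bsub>LR_ring D\<^esub> (n - 1))"
proof -
  interpret strips D using assms by (simp add: strips_def)
  have R_BGS: "R_BGS D = error_propagation R (\<one>\<^bsub>R\<^esub> \<ominus>\<^bsub>R\<^esub> M_r D \<ominus>\<^bsub>R\<^esub> M_l D \<ominus>\<^bsub>R\<^esub> A_r D)
      (\<one>\<^bsub>R\<^esub> \<ominus>\<^bsub>R\<^esub> (M_l D \<oplus>\<^bsub>R\<^esub> A_l D \<oplus>\<^bsub>R\<^esub> A_r D \<oplus>\<^bsub>R\<^esub> M_r D))"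
    by (simp add: R_BGS_def M_BGS_def LR_ring_eq flip: T_LR_blocks)
  show ?thesis
    unfolding R_BGS C_l_def C_r_def LR_ring_eq
    using block_gauss_seidel[OF blocks_closed diagonal_blocks_units block_products] by blast
qed

end
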